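(* Let $G=(V,E)$ be a graph with vertex set $V=\{1,\dots,n\}$ and let $m\ge 1$. Then $M(G)$ is the intersection of at most $m$ matroids on $E$ if and only if there exist values $x^a_{ij,ik}\in\{0,1\}$, for all $a\in\{1,\dots,m\}$ and all vertices $i,j,k$ with $ij,ik\in E$, $j<k$ (with the convention $x^a_{ik,ij}:=x^a_{ij,ik}$), satisfying all of the following: (i) (cover) $\sum_{a=1}^m x^a_{ij,ik}\ge 1$ for all $ij,ik\in E$ with $j<k$; (ii) (claw) for all $a$ and all distinct $i,j,k,l$ with $ij,ik,il\in E$: $x^a_{ij,ik}+x^a_{ij,il}-x^a_{ik,il}\le 1$, $x^a_{ij,ik}-x^a_{ij,il}+x^a_{ik,il}\le 1$, and $-x^a_{ij,ik}+x^a_{ij,il}+x^a_{ik,il}\le 1$; (iii) (triangle) for all $a$ and all distinct $i,j,k$ with $ij,ik,jk\in E$: $x^a_{ij,ik}+x^a_{ji,jk}-x^a_{ki,kj}\le 1$, $x^a_{ij,ik}-x^a_{ji,jk}+x^a_{ki,kj}\le 1$, and $-x^a_{ij,ik}+x^a_{ji,jk}+x^a_{ki,kj}\le 1$; (iv) (matching) for all $a$ and all distinct vertices $i,j,k,l$ with $ij,ik,kl\in E$: $x^a_{ij,ik}+x^a_{ki,kl}\le 1$.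
   Context: Graphs are finite, undirected, without loops or multiple edges; the edge with endpoints $i,j$ is written $ij=ji$. A matroid on a finite set $S$ is a family $\mathcal{M}$ of subsets of $S$ with $\emptyset\in\mathcal{M}$, closed under subsets, such that for every $A\subseteq S$ all maximal members of $\mathcal{M}$ contained in $A$ have the same cardinality. $M(G)$ denotes the family of all matchings of $G$ (sets of pairwise disjoint edges), as a family of subsets of $E$. The intersection of matroids $\mathcal{M}_1,\dots,\mathcal{M}_m$ on $E$ is $\mathcal{M}_1\cap\dots\cap\mathcal{M}_m$. *)

theory Defs
  imports Main
begin

definition simple_graph :: "'v set \<Rightarrow> 'v set set \<Rightarrow> bool" where
  "simple_graph V E \<longleftrightarrow> finite V \<and> (\<forall>e\<in>E. e \<subseteq> V \<and> card e = 2)"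

definition maximal_member_in :: "'a set set \<Rightarrow> 'a set \<Rightarrow> 'a set \<Rightarrow> bool" where
  "maximal_member_in M A X \<longleftrightarrow>
     X \<in> M \<and> X \<subseteq> A \<and> (\<forall>Y\<in>M. X \<subseteq> Y \<and> Y \<subseteq> A \<longrightarrow> Y = X)"

definition matroid_on :: "'a set \<Rightarrow> 'a set set \<Rightarrow> bool" where
  "matroid_on S M \<longleftrightarrow>
     finite S \<and> M \<subseteq> Pow S \<and> {} \<in> M \<and>
     (\<forall>X\<in>M. \<forall>Y. Y \<subseteq> X \<longrightarrow> Y \<in> M) \<and>
     (\<forall>A X Y. A \<subseteq> S \<and> maximal_member_in M A X \<and> maximal_member_in M A Y
        \<longrightarrow> card X = card Y)"

definition matchings :: "'v set set \<Rightarrow> 'v set set set" where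
  "matchings E = {F. F \<subseteq> E \<and> pairwise disjnt F}"

text \<open>The intersection of zero matroids is excluded; read as the power set of \<open>S\<close>, it would
  be the free matroid, so for \<open>m \<ge> 1\<close> nothing is lost.\<close>

definition intersection_of_at_most_matroids ::
    "nat \<Rightarrow> 'a set \<Rightarrow> 'a set set \<Rightarrow> bool" where
  "intersection_of_at_most_matroids m S F \<longleftrightarrow>
     (\<exists>r Ms. 1 \<le> r \<and> r \<le> m \<and> (\<forall>a\<in>{1..r}. matroid_on S (Ms a)) \<and> F = (\<Inter>a\<in>{1..r}. Ms a))"

end

theory Submission
  imports Defs
begin

text \<open>
  In a matroid without loops, being equal or parallel (forming a dependent pair) is an
  equivalence relation. If the matchings are an intersection of matroids, then
  \<open>x\<^sup>a\<^sub>e\<^sub>f = 1\<close> exactly when \<open>e\<close> and \<open>f\<close> are parallel in the \<open>a\<close>-th matroid is a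
  solution: (ii) and (iii) are transitivity of parallelism, and (iv) holds because
  the disjoint edges \<open>ij\<close>, \<open>kl\<close> are never parallel. Conversely, (ii)--(iv) say that the
  adjacent pairs with \<open>x\<^sup>a = 1\<close> generate no further pairs under transitivity, so each \<open>a\<close> yields
  a partition matroid, and by (i) these partition matroids intersect in the matchings.
\<close>

section \<open>Partition matroids\<close>

text \<open>The blocks are the fibres of \<open>f\<close>. An element of \<open>A\<close> whose
  value is missed could be added, so a maximal injective subset of \<open>A\<close> attains every
  value of \<open>f\<close> on \<open>A\<close> exactly once, which fixes its cardinality.\<close>

lemma matroid_on_inj_on:
  assumes "finite S"
  shows "matroid_on S {F. F \<subseteq> S \<and> inj_on f F}"
proof -
  let ?M = "{F. F \<subseteq> S \<and> inj_on f F}"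
  have card_max: "card X = card (f ` A)" if "A \<subseteq> S" and max: "maximal_member_in ?M A X" for A X
  proof -
    have X: "X \<subseteq> A" "inj_on f X"
      and ext: "\<And>Y. Y \<subseteq> S \<Longrightarrow> inj_on f Y \<Longrightarrow> X \<subseteq> Y \<Longrightarrow> Y \<subseteq> A \<Longrightarrow> Y = X"
      using max by (auto simp: maximal_member_in_def)
    have "f e \<in> f ` X" if "e \<in> A" for e
    proof (rule ccontr)
      assume e: "f e \<notin> f ` X"
      then have "inj_on f (insert e X)"
        using X by auto
      then have "insert e X = X"
        using ext[of "insert e X"] X \<open>A \<subseteq> S\<close> \<open>e \<in> A\<close> by auto
      with e show False by auto
    qed
    then have "f ` X = f ` A"
      using X by auto
    then show ?thesis
      using card_image[OF X(2)] by simp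
  qed
  have "?M \<subseteq> Pow S" "{} \<in> ?M"
    by auto
  moreover have "card X = card Y"
    if "A \<subseteq> S \<and> maximal_member_in ?M A X \<and> maximal_member_in ?M A Y" for A X Y
    using that card_max[of A X] card_max[of A Y] by simp
  moreover have "\<forall>X\<in>?M. \<forall>Y. Y \<subseteq> X \<longrightarrow> Y \<in> ?M"
    by (auto intro: inj_on_subset)
  ultimately show ?thesis
    using assms unfolding matroid_on_def by (intro conjI allI impI)
qed

section \<open>Parallel elements of a matroid\<close>

lemma maximal_member_inI:
  assumes "X \<in> M" "X \<subseteq> A" "\<And>Y. \<lbrakk>Y \<in> M; X \<subseteq> Y; Y \<subseteq> A\<rbrakk> \<Longrightarrow> Y = X"
  shows "maximal_member_in M A X"
  unfolding maximal_member_in_def by (intro conjI ballI impI assms) simp_all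

lemma
  assumes "matroid_on S M"
  shows matroid_on_subset_carrier: "M \<subseteq> Pow S"
    and matroid_on_subset_closed: "\<lbrakk>X \<in> M; Y \<subseteq> X\<rbrakk> \<Longrightarrow> Y \<in> M"
    and matroid_on_card_maximal_eq:
      "\<lbrakk>A \<subseteq> S; maximal_member_in M A X; maximal_member_in M A Y\<rbrakk> \<Longrightarrow> card X = card Y"
proof -
  have M: "M \<subseteq> Pow S" "\<forall>X\<in>M. \<forall>Y. Y \<subseteq> X \<longrightarrow> Y \<in> M"
    "\<forall>A X Y. A \<subseteq> S \<and> maximal_member_in M A X \<and> maximal_member_in M A Y \<longrightarrow> card X = card Y"
    using assms unfolding matroid_on_def by - (elim conjE, assumption)+
  show "M \<subseteq> Pow S"
    by (rule M(1))
  show "\<lbrakk>X \<in> M; Y \<subseteq> X\<rbrakk> \<Longrightarrow> Y \<in> M"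
    using M(2) by simp
  show "\<lbrakk>A \<subseteq> S; maximal_member_in M A X; maximal_member_in M A Y\<rbrakk> \<Longrightarrow> card X = card Y"
    by (rule M(3)[rule_format]) (intro conjI)
qed

text \<open>If \<open>{e, g}\<close> were independent, then \<open>{f}\<close> and
  \<open>{e, g}\<close> would be maximal in \<open>{e, f, g}\<close> with different cardinalities.
  Independence of \<open>{f}\<close> excludes a loop, which is dependent with everything.\<close>

lemma matroid_on_parallel_trans:
  assumes M: "matroid_on S M" and f: "{f} \<in> M"
    and ef: "{e, f} \<notin> M" and fg: "{f, g} \<notin> M" and "e \<noteq> g"
  shows "{e, g} \<notin> M"
proof
  assume eg: "{e, g} \<in> M"
  note sub = matroid_on_subset_closed[OF M]
  have S: "{e, f, g} \<subseteq> S"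
    using matroid_on_subset_carrier[OF M] f eg by blast
  have max_f: "maximal_member_in M {e, f, g} {f}"
  proof (rule maximal_member_inI)
    fix Y assume "Y \<in> M" "{f} \<subseteq> Y" "Y \<subseteq> {e, f, g}"
    then show "Y = {f}"
      using sub[of Y "{e, f}"] sub[of Y "{f, g}"] ef fg by blast
  qed (use f in simp_all)
  have "maximal_member_in M {e, f, g} {e, g}"
  proof (rule maximal_member_inI)
    fix Y assume "Y \<in> M" "{e, g} \<subseteq> Y" "Y \<subseteq> {e, f, g}"
    then show "Y = {e, g}"
      using sub[of Y "{e, f}"] ef by blast
  qed (use eg in simp_all)
  then have "card {f} = card {e, g}"
    using matroid_on_card_maximal_eq[OF M S max_f] by blast
  with \<open>e \<noteq> g\<close> show False by simp
qed

section \<open>Adjacent edges of a simple graph\<close>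

lemma pair_in_matchings_iff:
  assumes "e \<in> E" "f \<in> E" "e \<noteq> f"
  shows "{e, f} \<in> matchings E \<longleftrightarrow> e \<inter> f = {}"
  using assms by (auto simp: matchings_def pairwise_def disjnt_def)

lemma simple_graph_edgeE:
  assumes "simple_graph V E" "e \<in> E" "v \<in> e"
  obtains w where "e = {v, w}" "v \<noteq> w" "v \<in> V" "w \<in> V"
proof -
  have "card e = 2" "e \<subseteq> V"
    using assms by (auto simp: simple_graph_def)
  then obtain p q where "e = {p, q}" "p \<noteq> q"
    by (auto simp: card_2_iff)
  with \<open>v \<in> e\<close> \<open>e \<subseteq> V\<close> that[of p] that[of q] show thesis
    by auto
qed

text \<open>The conditions on \<open>x\<close> are indexed by vertices; this form lets them be
  applied to adjacent edges given as sets.\<close>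

lemma simple_graph_adjacent_edgesE:
  assumes "simple_graph V E" "e \<in> E" "f \<in> E" "e \<noteq> f" "e \<inter> f \<noteq> {}"
  obtains i j k where "e = {i, j}" "f = {i, k}" "distinct [i, j, k]" "i \<in> V" "j \<in> V" "k \<in> V"
proof -
  obtain i where "i \<in> e" "i \<in> f"
    using assms by blast
  obtain j where "e = {i, j}" "i \<noteq> j" "i \<in> V" "j \<in> V"
    using simple_graph_edgeE[OF assms(1,2) \<open>i \<in> e\<close>] .
  moreover obtain k where "f = {i, k}" "i \<noteq> k" "k \<in> V"
    using simple_graph_edgeE[OF assms(1,3) \<open>i \<in> f\<close>] .
  ultimately show thesis
    using that \<open>e \<noteq> f\<close> by auto
qed

lemma simple_graph_finite_edges:
  assumes "simple_graph V E"
  shows "finite E"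
proof (rule finite_subset)
  show "E \<subseteq> Pow V" "finite (Pow V)"
    using assms by (auto simp: simple_graph_def)
qed

theorem theorem3:
  fixes n m :: nat and V :: "nat set" and E :: "nat set set"
  assumes "V = {1..n}" and "simple_graph V E" and "m \<ge> 1"
  shows "intersection_of_at_most_matroids m E (matchings E) \<longleftrightarrow>
    (\<exists>x :: nat \<Rightarrow> nat set \<Rightarrow> nat set \<Rightarrow> int.
      (\<forall>a\<in>{1..m}. \<forall>i\<in>V. \<forall>j\<in>V. \<forall>k\<in>V. {i,j} \<in> E \<and> {i,k} \<in> E \<and> j < k \<longrightarrow>
          x a {i,j} {i,k} \<in> {0, 1} \<and> x a {i,k} {i,j} = x a {i,j} {i,k}) \<and>
      (\<forall>i\<in>V. \<forall>j\<in>V. \<forall>k\<in>V. {i,j} \<in> E \<and> {i,k} \<in> E \<and> j < k \<longrightarrow>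
          (\<Sum>a=1..m. x a {i,j} {i,k}) \<ge> 1) \<and>
      (\<forall>a\<in>{1..m}. \<forall>i\<in>V. \<forall>j\<in>V. \<forall>k\<in>V. \<forall>l\<in>V.
          distinct [i, j, k, l] \<and> {i,j} \<in> E \<and> {i,k} \<in> E \<and> {i,l} \<in> E \<longrightarrow>
            x a {i,j} {i,k} + x a {i,j} {i,l} - x a {i,k} {i,l} \<le> 1 \<and>
            x a {i,j} {i,k} - x a {i,j} {i,l} + x a {i,k} {i,l} \<le> 1 \<and>
            - x a {i,j} {i,k} + x a {i,j} {i,l} + x a {i,k} {i,l} \<le> 1) \<and>
      (\<forall>a\<in>{1..m}. \<forall>i\<in>V. \<forall>j\<in>V. \<forall>k\<in>V.
          distinct [i, j, k] \<and> {i,j} \<in> E \<and> {i,k} \<in> E \<and> {j,k} \<in> E \<longrightarrow>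
            x a {i,j} {i,k} + x a {j,i} {j,k} - x a {k,i} {k,j} \<le> 1 \<and>
            x a {i,j} {i,k} - x a {j,i} {j,k} + x a {k,i} {k,j} \<le> 1 \<and>
            - x a {i,j} {i,k} + x a {j,i} {j,k} + x a {k,i} {k,j} \<le> 1) \<and>
      (\<forall>a\<in>{1..m}. \<forall>i\<in>V. \<forall>j\<in>V. \<forall>k\<in>V. \<forall>l\<in>V.
          distinct [i, j, k, l] \<and> {i,j} \<in> E \<and> {i,k} \<in> E \<and> {k,l} \<in> E \<longrightarrow>
            x a {i,j} {i,k} + x a {k,i} {k,l} \<le> 1))"
  (is "?L \<longleftrightarrow> (\<exists>x. ?bin x \<and> ?cov x \<and> ?claw x \<and> ?tri x \<and> ?mat x)")
proof

  \<comment> \<open>From matroids to a solution of the system\<close>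
  assume ?L
  then obtain r Ms where r: "1 \<le> r" "r \<le> m" and Ms: "\<forall>a\<in>{1..r}. matroid_on E (Ms a)"
    and inter: "matchings E = (\<Inter>a\<in>{1..r}. Ms a)"
    by (auto simp: intersection_of_at_most_matroids_def)
  \<comment> \<open>The family is padded to exactly \<open>m\<close> members by repeating
    \<open>Ms 1\<close>, which leaves the intersection unchanged.\<close>
  define N where "N a = (if a \<le> r then Ms a else Ms 1)" for a
  \<comment> \<open>Disjoint edges get a value too, so that transitivity can be stated for all
    edges; the matching condition is derived from it.\<close>
  define x :: "nat \<Rightarrow> nat set \<Rightarrow> nat set \<Rightarrow> int"
    where "x a e f = (if {e, f} \<in> N a then 0 else 1)" for a e f
  have N: "matroid_on E (N a)" "matchings E \<subseteq> N a" if "a \<in> {1..m}" for a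
    using that r Ms inter by (auto simp: N_def)
  have N_inter: "F \<in> matchings E" if "\<And>a. a \<in> {1..m} \<Longrightarrow> F \<in> N a" for F
  proof -
    have "F \<in> Ms a" if "a \<in> {1..r}" for a
      using \<open>\<And>a. a \<in> {1..m} \<Longrightarrow> F \<in> N a\<close>[of a] that r by (auto simp: N_def)
    then show ?thesis
      unfolding inter by blast
  qed
  have x01: "x a e f = 0 \<or> x a e f = 1" for a e f
    by (simp add: x_def)
  have x_commute: "x a e f = x a f e" for a e f
    by (simp add: x_def insert_commute)
  \<comment> \<open>Singletons are matchings, so no edge is a loop of \<open>N a\<close>.\<close>
  have x_trans: "x a e g = 1"
    if "a \<in> {1..m}" "f \<in> E" "e \<noteq> g" "x a e f = 1" "x a f g = 1" for a e f g
  proof -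
    have "{f} \<in> N a"
      using N(2)[OF that(1)] \<open>f \<in> E\<close> by (auto simp: matchings_def)
    then show ?thesis
      using matroid_on_parallel_trans[OF N(1)[OF that(1)], of f e g] that
      by (auto simp: x_def split: if_splits)
  qed
  \<comment> \<open>For 0/1 values each inequality fails only if the two positive terms are 1 and
    the negative one is 0, which contradicts transitivity through the edge common to the positive
    terms. The claw and triangle conditions are both instances.\<close>
  have x_tri: "x a e f + x a e g - x a f g \<le> 1 \<and> x a e f - x a e g + x a f g \<le> 1 \<and>
      - x a e f + x a e g + x a f g \<le> 1"
    if "a \<in> {1..m}" "e \<in> E" "f \<in> E" "g \<in> E" "e \<noteq> f" "e \<noteq> g" "f \<noteq> g" for a e f g
    using x_trans[OF that(1), of e f g] x_trans[OF that(1), of f e g] x_trans[OF that(1), of g e f]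
      x01[of a e f] x01[of a e g] x01[of a f g] that
    by (auto simp: x_commute[of a f e] x_commute[of a g f])
  have "?bin x"
    using x01 x_commute by auto
  moreover have "?cov x"
  proof (intro ballI impI)
    fix i j k assume "i \<in> V" and E: "{i, j} \<in> E \<and> {i, k} \<in> E \<and> j < k"
    then have "{i, j} \<noteq> {i, k}"
      by (auto simp: doubleton_eq_iff)
    then have "{{i, j}, {i, k}} \<notin> matchings E"
      using E by (subst pair_in_matchings_iff) auto
    \<comment> \<open>Adjacent edges are no matching, so some \<open>N a\<close> makes them
      dependent. The summand of this \<open>a\<close> is 1 and the others are nonnegative.\<close>
    then obtain a where a: "a \<in> {1..m}" "{{i, j}, {i, k}} \<notin> N a"
      using N_inter by blast
    have "x a {i, j} {i, k} \<le> (\<Sum>a=1..m. x a {i, j} {i, k})"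
      using a(1) by (intro member_le_sum) (auto simp: x_def)
    with a(2) show "(\<Sum>a=1..m. x a {i, j} {i, k}) \<ge> 1"
      by (simp add: x_def)
  qed
  moreover have "?claw x"
    by (intro ballI impI x_tri) (auto simp: doubleton_eq_iff)
  moreover have "?tri x"
  proof (intro ballI impI)
    fix a i j k
    assume "a \<in> {1..m}" "distinct [i, j, k] \<and> {i,j} \<in> E \<and> {i,k} \<in> E \<and> {j,k} \<in> E"
    then show "x a {i,j} {i,k} + x a {j,i} {j,k} - x a {k,i} {k,j} \<le> 1 \<and>
            x a {i,j} {i,k} - x a {j,i} {j,k} + x a {k,i} {k,j} \<le> 1 \<and>
            - x a {i,j} {i,k} + x a {j,i} {j,k} + x a {k,i} {k,j} \<le> 1"
      using x_tri[of a "{i,j}" "{i,k}" "{j,k}"]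
      by (auto simp: doubleton_eq_iff insert_commute)
  qed
  moreover have "?mat x"
  proof (intro ballI impI)
    fix a i j k l
    assume a: "a \<in> {1..m}"
      and *: "distinct [i, j, k, l] \<and> {i,j} \<in> E \<and> {i,k} \<in> E \<and> {k,l} \<in> E"
    then have ne: "{i,j} \<noteq> {k,l}"
      by (auto simp: doubleton_eq_iff)
    then have "{{i,j}, {k,l}} \<in> matchings E"
      using * by (subst pair_in_matchings_iff) auto
    \<comment> \<open>Were both terms of the claim 1, the disjoint edges \<open>{i,j}\<close> and
      \<open>{k,l}\<close> would be parallel through \<open>{i,k}\<close>.\<close>
    then have "x a {i,j} {k,l} = 0"
      using N(2)[OF a] by (auto simp: x_def)
    then show "x a {i,j} {i,k} + x a {k,i} {k,l} \<le> 1"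
      using x_trans[OF a, of "{i,k}" "{i,j}" "{k,l}"] ne *
        x01[of a "{i,j}" "{i,k}"] x01[of a "{i,k}" "{k,l}"]
      by (auto simp: insert_commute)
  qed
  ultimately show "\<exists>x. ?bin x \<and> ?cov x \<and> ?claw x \<and> ?tri x \<and> ?mat x"
    by (intro exI[of _ x] conjI)
next

  \<comment> \<open>From a solution of the system to partition matroids\<close>
  assume "\<exists>x. ?bin x \<and> ?cov x \<and> ?claw x \<and> ?tri x \<and> ?mat x"
  then obtain x where bin: "?bin x" and cov: "?cov x" and claw: "?claw x"
    and tri: "?tri x" and mat: "?mat x"
    by (elim exE conjE) (rule that)
  note edgesE = simple_graph_adjacent_edgesE[OF assms(2)]
  \<comment> \<open>The system constrains \<open>x\<close> only at distinct adjacent edges, so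
    adjacency is demanded explicitly and the diagonal is added by hand.\<close>
  define R where "R a = {(e, f). e \<in> E \<and> f \<in> E \<and> (e = f \<or> e \<inter> f \<noteq> {} \<and> x a e f = 1)}" for a
  have x_commute: "x a e f = x a f e"
    if "a \<in> {1..m}" and ef: "e \<in> E" "f \<in> E" and meet: "e \<inter> f \<noteq> {}" for a e f
  proof (cases "e = f")
    case False
    then obtain i j k where "e = {i, j}" "f = {i, k}" "distinct [i, j, k]"
      "i \<in> V" "j \<in> V" "k \<in> V"
      by (rule edgesE[OF ef _ meet])
    then show ?thesis
      using bin[rule_format, of a i j k] bin[rule_format, of a i k j] that
      by (cases j k rule: linorder_cases) auto
  qed simp
  have cover_less: "\<exists>a\<in>{1..m}. x a {i, j} {i, k} = 1"
    if ijk: "i \<in> V" "j \<in> V" "k \<in> V" "{i, j} \<in> E" "{i, k} \<in> E" "j < k" for i j k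
  proof (rule ccontr)
    assume "\<not> ?thesis"
    then have "x a {i, j} {i, k} = 0" if "a \<in> {1..m}" for a
      using bin[rule_format, of a i j k] ijk that by auto
    then have "(\<Sum>a=1..m. x a {i, j} {i, k}) = 0"
      by (intro sum.neutral) blast
    with cov[rule_format, of i j k] ijk show False
      by simp
  qed
  have cover: "\<exists>a\<in>{1..m}. x a e f = 1"
    if ef: "e \<in> E" "f \<in> E" "e \<noteq> f" "e \<inter> f \<noteq> {}" for e f
  proof -
    obtain i j k where *: "e = {i, j}" "f = {i, k}" "distinct [i, j, k]"
      "i \<in> V" "j \<in> V" "k \<in> V"
      by (rule edgesE[OF ef])
    consider "j < k" | "k < j"
      using * by fastforce
    then show ?thesis
    proof cases
      case 1
      with cover_less[of i j k] * ef show ?thesis by simp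
    next
      case 2
      with cover_less[of i k j] * ef have "\<exists>a\<in>{1..m}. x a f e = 1" by simp
      then show ?thesis
        using x_commute[OF _ ef(1,2,4)] by metis
    qed
  qed
  have R_trans: "(e, g) \<in> R a"
    if a: "a \<in> {1..m}" and "(e, f) \<in> R a" "(f, g) \<in> R a" for a e f g
  proof (cases "e = f \<or> f = g \<or> e = g")
    case True
    then show ?thesis
      using that by (auto simp: R_def)
  next
    case False
    then have ne: "e \<noteq> f" "e \<noteq> g"
      by auto
    have ef: "e \<in> E" "f \<in> E" "e \<inter> f \<noteq> {}" "x a e f = 1"
      and fg: "g \<in> E" "f \<inter> g \<noteq> {}" "x a f g = 1"
      using that False by (auto simp: R_def)
    obtain i j k where ijk: "e = {i, j}" "f = {i, k}" "distinct [i, j, k]"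
      "i \<in> V" "j \<in> V" "k \<in> V"
      by (rule edgesE[OF ef(1,2) ne(1) ef(3)])
    \<comment> \<open>The inequalities below only bound \<open>x a e g\<close> from below; the
      binary condition turns this into the value 1.\<close>
    have eg: "(e, g) \<in> R a" if "e \<inter> g \<noteq> {}" "x a e g \<ge> 1"
    proof -
      obtain i j k where "e = {i, j}" "g = {i, k}" "distinct [i, j, k]"
        "i \<in> V" "j \<in> V" "k \<in> V"
        by (rule edgesE[OF ef(1) fg(1) ne(2) \<open>e \<inter> g \<noteq> {}\<close>])
      then have "x a e g \<in> {0, 1}"
        using bin[rule_format, of a i j k] bin[rule_format, of a i k j] a
          x_commute[OF a ef(1) fg(1) that(1)] ef(1) fg(1)
        by (cases j k rule: linorder_cases) auto
      then show ?thesis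
        using that ef(1) fg(1) by (auto simp: R_def)
    qed
    \<comment> \<open>The edge \<open>g\<close> meets \<open>f\<close> in \<open>i\<close>, giving a
      claw with centre \<open>i\<close>, or only in \<open>k\<close>, giving a triangle or a path on
      four vertices.\<close>
    consider "i \<in> g" | "k \<in> g" "i \<notin> g"
      using fg ijk by blast
    then show ?thesis
    proof cases
      case 1
      then obtain l where l: "g = {i, l}" "i \<noteq> l" "l \<in> V"
        by (rule simple_graph_edgeE[OF assms(2) fg(1)])
      then have d: "distinct [i, j, k, l]"
        using ijk False by auto
      then have "x a {i,j} {i,k} - x a {i,j} {i,l} + x a {i,k} {i,l} \<le> 1"
        using claw[rule_format, of a i j k l] a ijk l ef fg by simp
      then show ?thesis
        using ef fg by (intro eg) (auto simp: ijk l)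
    next
      case 2
      from 2(1) obtain l where l: "g = {k, l}" "k \<noteq> l" "l \<in> V"
        by (rule simple_graph_edgeE[OF assms(2) fg(1)])
      show ?thesis
      proof (cases "l = j")
        case True
        then have "x a {i,j} {i,k} - x a {j,i} {j,k} + x a {k,i} {k,j} \<le> 1"
          using tri[rule_format, of a i j k] a ijk l ef fg by (simp add: insert_commute)
        then show ?thesis
          using ef fg True by (intro eg) (auto simp: ijk l insert_commute)
      next
        case False
        then have "distinct [i, j, k, l]"
          using ijk l 2 by auto
        \<comment> \<open>Here \<open>e\<close> and \<open>g\<close> are disjoint ends of a path
          with middle edge \<open>f\<close>. Both terms are 1 by assumption, so the case is
          impossible.\<close>
        then have "x a {i,j} {i,k} + x a {k,i} {k,l} \<le> 1"
          using mat[rule_format, of a i j k l] a ijk l ef fg by simp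
        then show ?thesis
          using ef(4) fg(3) by (simp add: ijk l insert_commute)
      qed
    qed
  qed
  have equiv: "equiv E (R a)" if a: "a \<in> {1..m}" for a
  proof (rule equivI)
    show "R a \<subseteq> E \<times> E" "refl_on E (R a)"
      by (auto simp: R_def refl_on_def)
    show "sym (R a)"
      by (rule symI) (use x_commute[OF a] in \<open>simp add: R_def Int_commute, metis\<close>)
    show "trans (R a)"
      using R_trans[OF a] by (auto simp: trans_def)
  qed
  \<comment> \<open>Independent sets contain at most one edge of each class of \<open>R a\<close>.
    Being a matroid needs only a map on edges; that \<open>R a\<close> is an equivalence serves to
    characterise membership in \<open>Ms_iff\<close>.\<close>
  define Ms where "Ms a = {F. F \<subseteq> E \<and> inj_on (\<lambda>e. R a `` {e}) F}" for a
  have Ms_iff: "F \<in> Ms a \<longleftrightarrow>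
      F \<subseteq> E \<and> (\<forall>e\<in>F. \<forall>f\<in>F. e \<noteq> f \<longrightarrow> e \<inter> f = {} \<or> x a e f \<noteq> 1)" if a: "a \<in> {1..m}" for a F
  proof -
    have "R a `` {e} = R a `` {f} \<longleftrightarrow> e = f \<or> e \<inter> f \<noteq> {} \<and> x a e f = 1" if "e \<in> E" "f \<in> E" for e f
      unfolding eq_equiv_class_iff[OF equiv[OF a] that] using that by (simp add: R_def)
    then show ?thesis
      unfolding Ms_def inj_on_def mem_Collect_eq by (metis (lifting) subsetD)
  qed
  have "matroid_on E (Ms a)" for a
    unfolding Ms_def using simple_graph_finite_edges[OF assms(2)] by (rule matroid_on_inj_on)
  moreover have "matchings E = (\<Inter>a\<in>{1..m}. Ms a)"
  proof (intro equalityI subsetI INT_I)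
    fix F a assume "F \<in> matchings E" "a \<in> {1..m}"
    then show "F \<in> Ms a"
      by (auto simp: Ms_iff matchings_def pairwise_def disjnt_def)
  next
    fix F assume "F \<in> (\<Inter>a\<in>{1..m}. Ms a)"
    then have F: "F \<in> Ms a" if "a \<in> {1..m}" for a
      using that by blast
    \<comment> \<open>The index 1 is available because \<open>m \<ge> 1\<close>.\<close>
    have FE: "F \<subseteq> E"
      using F[of 1] \<open>m \<ge> 1\<close> by (auto simp: Ms_def)
    have "e \<inter> f = {}" if ef: "e \<in> F" "f \<in> F" "e \<noteq> f" for e f
    proof (rule ccontr)
      assume meet: "e \<inter> f \<noteq> {}"
      \<comment> \<open>The cover condition puts two adjacent edges into one class for some
        \<open>a\<close>, so \<open>Ms a\<close> cannot contain a set with both.\<close>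
      then obtain a where "a \<in> {1..m}" "x a e f = 1"
        using cover ef FE by blast
      then show False
        using F[of a] ef meet by (auto simp: Ms_iff)
    qed
    with FE show "F \<in> matchings E"
      by (auto simp: matchings_def pairwise_def disjnt_def)
  qed
  ultimately show ?L
    unfolding intersection_of_at_most_matroids_def using \<open>m \<ge> 1\<close> by blast
qed

end
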